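(* There exists an abelian $9$-power free morphism $h:\Sigma^*\to\Sigma^*$ over the binary alphabet $\Sigma=\{a,b\}$ with an infinite fixed point $\Omega_2\in\Sigma^{\mathbb{N}}$ such that: (i) $aaaa$ is not a factor of $\Omega_2$; (ii) $bb$ is not a factor of $\Omega_2$; (iii) $\Omega_2$ is abelian $9$-power free.
   Context: $\Sigma^*$ is the free monoid of finite words over $\Sigma$, with empty word $\epsilon$. A morphism is a monoid homomorphism $h:\Sigma^*\to\Sigma^*$; it extends to infinite words letter by letter, and an infinite word $\Omega$ is a fixed point of $h$ if $h(\Omega)=\Omega$. A factor of a word is a contiguous finite subword. The Parikh vector $\psi(u)$ of a finite word $u$ records the number of occurrences of each letter in $u$. A word $u$ (finite or infinite) is abelian $k$-power free if whenever $u=xv_1\cdots v_ky$ with $\psi(v_1)=\cdots=\psi(v_k)$, one has $v_1=\cdots=v_k=\epsilon$. A morphism $h$ is abelian $n$-power free if $h(u)$ is abelian $n$-power free for every abelian $n$-power free word $u$. *)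

theory Defs
  imports "HOL-Library.Omega_Words_Fun"
begin

datatype letter = A | B

definition morphism :: "('a list \<Rightarrow> 'b list) \<Rightarrow> bool" where
  "morphism h \<longleftrightarrow> h [] = [] \<and> (\<forall>u v. h (u @ v) = h u @ h v)"

(* omega_image h w w' reads h(w) = w', where h(w) is the concatenation h(w 0) h(w 1) h(w 2) ...
   A relation is used because h may erase letters: if this concatenation is a finite word,
   then no infinite word w' is the image of w. *)
definition omega_image :: "('a list \<Rightarrow> 'b list) \<Rightarrow> 'a word \<Rightarrow> 'b word \<Rightarrow> bool" where
  "omega_image h w w' \<longleftrightarrow>
     (\<forall>n. \<exists>y. w' = concat (map (\<lambda>i. h [w i]) [0..<n]) \<frown> y) \<and>
     (\<forall>m. \<exists>n. m \<le> length (concat (map (\<lambda>i. h [w i]) [0..<n])))"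

lemma omega_image_unique:
  assumes "omega_image h w w1" and "omega_image h w w2"
  shows "w1 = w2"
proof
  fix i
  obtain n where n: "Suc i \<le> length (concat (map (\<lambda>i. h [w i]) [0..<n]))"
    using assms(1) unfolding omega_image_def by blast
  obtain y1 where "w1 = concat (map (\<lambda>i. h [w i]) [0..<n]) \<frown> y1"
    using assms(1) unfolding omega_image_def by blast
  moreover obtain y2 where "w2 = concat (map (\<lambda>i. h [w i]) [0..<n]) \<frown> y2"
    using assms(2) unfolding omega_image_def by blast
  ultimately show "w1 i = w2 i"
    using n by (simp add: conc_def)
qed

definition omega_fixed_point :: "('a list \<Rightarrow> 'a list) \<Rightarrow> 'a word \<Rightarrow> bool" where
  "omega_fixed_point h w \<longleftrightarrow> omega_image h w w"

definition omega_factor :: "'a list \<Rightarrow> 'a word \<Rightarrow> bool" where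
  "omega_factor u w \<longleftrightarrow> (\<exists>x y. w = x \<frown> u \<frown> y)"

definition parikh :: "'a list \<Rightarrow> ('a \<Rightarrow> nat)" where
  "parikh u = (\<lambda>c. count_list u c)"

definition abelian_power_free :: "nat \<Rightarrow> 'a list \<Rightarrow> bool" where
  "abelian_power_free k u \<longleftrightarrow>
     (\<forall>x vs y. u = x @ concat vs @ y \<and> length vs = k \<and>
        (\<forall>v \<in> set vs. \<forall>v' \<in> set vs. parikh v = parikh v') \<longrightarrow>
        (\<forall>v \<in> set vs. v = []))"

definition omega_abelian_power_free :: "nat \<Rightarrow> 'a word \<Rightarrow> bool" where
  "omega_abelian_power_free k w \<longleftrightarrow>
     (\<forall>x vs y. w = x \<frown> concat vs \<frown> y \<and> length vs = k \<and>
        (\<forall>v \<in> set vs. \<forall>v' \<in> set vs. parikh v = parikh v') \<longrightarrow>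
        (\<forall>v \<in> set vs. v = []))"

definition abelian_power_free_morphism :: "nat \<Rightarrow> ('a list \<Rightarrow> 'b list) \<Rightarrow> bool" where
  "abelian_power_free_morphism n h \<longleftrightarrow>
     morphism h \<and> (\<forall>u. abelian_power_free n u \<longrightarrow> abelian_power_free n (h u))"

end

theory Submission
  imports Defs "HOL-Library.Sublist"
begin

text \<open>
  The morphism, found by computer search, satisfies Dekking's criterion. The weight x + 3 y of a
  Parikh vector (x, y), taken modulo 31, vanishes on the images of both letters, and the weights of
  their proper prefixes occupy only 21 of the 31 residues. These contain no arithmetic progression
  of length 10 with nonzero difference, so the ten cut points of an abelian 9-power in an image all
  have the same weight modulo 31. Cut points with the same weight can be shifted simultaneously to
  block boundaries by the same Parikh vector, and as the incidence matrix of the morphism is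
  invertible, the shifted cuts delimit an abelian 9-power in the preimage. The fixed point is the
  limit of the iterates on the letter \<open>A\<close>; both images are products of AB, AAB and AAAB,
  which excludes AAAA and BB.
\<close>

section \<open>Abelian powers described by their cut points\<close>

text \<open>A power is handled through its \<open>k + 1\<close> cuts: prefixes of \<open>w\<close>
  whose Parikh vectors form an arithmetic progression. Prefixes of one word are comparable and
  \<open>0 < d c0\<close> makes them strictly increasing, so consecutive differences are the
  blocks.\<close>

lemma not_abelian_power_freeI:
  assumes pre: "\<And>j. j \<le> k \<Longrightarrow> Sublist.prefix (p j) w"
    and cnt: "\<And>j c. j \<le> k \<Longrightarrow> count_list (p j) c = count_list (p 0) c + j * d c"
    and "0 < k" and "0 < d c0"
  shows "\<not> abelian_power_free k w"
proof -
  define v where "v j = drop (length (p j)) (p (Suc j))" for j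
  have step: "p (Suc j) = p j @ v j" if "j < k" for j
  proof -
    have "Sublist.prefix (p j) (p (Suc j)) \<or> Sublist.prefix (p (Suc j)) (p j)"
      using pre[of j] pre[of "Suc j"] that prefix_same_cases by (metis Suc_leI less_imp_le)
    moreover have "\<not> Sublist.prefix (p (Suc j)) (p j)"
    proof
      assume "Sublist.prefix (p (Suc j)) (p j)"
      then have "count_list (p (Suc j)) c0 \<le> count_list (p j) c0"
        by (auto simp: prefix_def)
      then show False
        using cnt[of j c0] cnt[of "Suc j" c0] that \<open>0 < d c0\<close> by simp
    qed
    ultimately show ?thesis by (auto simp: v_def prefix_def)
  qed
  have parikh_v: "parikh (v j) = d" if "j < k" for j
    using arg_cong[OF step[OF that], of count_list] cnt[of j] cnt[of "Suc j"] that
    by (auto simp: parikh_def fun_eq_iff)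
  have p_eq: "p j = p 0 @ concat (map v [0..<j])" if "j \<le> k" for j
    using that by (induction j) (simp_all add: step)
  obtain y where "w = p k @ y"
    using pre[of k] by (auto simp: prefix_def)
  then have "w = p 0 @ concat (map v [0..<k]) @ y"
    using p_eq[of k] by simp
  moreover have "\<forall>u \<in> set (map v [0..<k]). parikh u = d"
    using parikh_v by simp
  moreover have "v 0 \<noteq> []"
    using parikh_v[of 0] \<open>0 < k\<close> \<open>0 < d c0\<close> by (auto simp: parikh_def)
  moreover have "v 0 \<in> set (map v [0..<k])"
    using \<open>0 < k\<close> by simp
  moreover have "length (map v [0..<k]) = k" by simp
  ultimately show ?thesis
    unfolding abelian_power_free_def by metis
qed

lemma not_abelian_power_freeE:
  assumes "\<not> abelian_power_free k w"
  obtains p d c0 where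
    "\<And>j. j \<le> k \<Longrightarrow> Sublist.prefix (p j) w"
    "\<And>j c. j \<le> k \<Longrightarrow> count_list (p j) c = count_list (p 0) c + j * d c"
    "0 < d c0"
proof -
  obtain x vs y v0 where w: "w = x @ concat vs @ y" and "length vs = k"
    and eq: "\<forall>v \<in> set vs. \<forall>v' \<in> set vs. parikh v = parikh v'"
    and v0: "v0 \<in> set vs" "v0 \<noteq> []"
    using assms unfolding abelian_power_free_def by blast
  define p where "p j = x @ concat (take j vs)" for j
  show thesis
  proof (rule that)
    show "Sublist.prefix (p j) w" for j
    proof -
      have "concat vs = concat (take j vs) @ concat (drop j vs)"
        by (simp flip: concat_append)
      then show ?thesis by (simp add: w p_def)
    qed
    show "count_list (p j) c = count_list (p 0) c + j * parikh v0 c" if "j \<le> k" for j c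
      using that
    proof (induction j)
      case (Suc j)
      have "parikh (vs ! j) = parikh v0"
        using eq v0(1) nth_mem[of j vs] Suc.prems \<open>length vs = k\<close> by (meson Suc_le_lessD)
      moreover have "p (Suc j) = p j @ vs ! j"
        using Suc.prems \<open>length vs = k\<close> by (simp add: p_def take_Suc_conv_app_nth)
      ultimately show ?case
        using Suc by (simp add: parikh_def fun_eq_iff)
    qed simp
    show "0 < parikh v0 (hd v0)"
      using v0(2) by (cases v0) (simp_all add: parikh_def)
  qed
qed

section \<open>The morphism and its incidence matrix\<close>

fun hl :: "letter \<Rightarrow> letter list" where
  "hl A = [A,B,A,A,A,B,A,A,A,B,A,A,A,B,A,A,B,A,B]"
| "hl B = [A,B,A,A,A,B,A,A,B,A,B,A,B,A,B,A,B]"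

definition h :: "letter list \<Rightarrow> letter list" where
  "h w = concat (map hl w)"

text \<open>The Parikh vectors (13, 6) and (10, 7) of the two images generate a lattice of index 31 in
  the integer plane, namely the vectors of weight 0 modulo 31.\<close>

definition weight :: "letter list \<Rightarrow> nat" where
  "weight w = count_list w A + 3 * count_list w B"

lemma h_simps [simp]: "h [] = []" "h (c # w) = hl c @ h w" "h (u @ v) = h u @ h v"
  by (simp_all add: h_def)

lemma morphism_h: "morphism h"
  by (simp add: morphism_def)

lemma count_h:
  "count_list (h w) A = 13 * count_list w A + 10 * count_list w B"
  "count_list (h w) B = 6 * count_list w A + 7 * count_list w B"
proof -
  have "count_list (h w) A = 13 * count_list w A + 10 * count_list w B \<and>
    count_list (h w) B = 6 * count_list w A + 7 * count_list w B"
  proof (induction w)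
    case (Cons c w)
    then show ?case by (cases c) auto
  qed simp
  then show "count_list (h w) A = 13 * count_list w A + 10 * count_list w B"
    "count_list (h w) B = 6 * count_list w A + 7 * count_list w B" by auto
qed

lemma weight_append [simp]: "weight (u @ v) = weight u + weight v"
  by (simp add: weight_def)

lemma weight_hl [simp]: "weight (hl c) = 31"
  by (cases c) (simp_all add: weight_def)

lemma weight_h: "weight (h w) = 31 * (count_list w A + count_list w B)"
  by (simp add: weight_def count_h)

text \<open>A cut at a block boundary before the end of \<open>h w\<close> falls under the second
  case, with \<open>t\<close> empty; only the end itself has no next letter
  \<open>c\<close>.\<close>

lemma prefix_h_cases:
  assumes "Sublist.prefix p (h w)"
  obtains "p = h w"
  | u c t where "p = h u @ t" "Sublist.prefix (u @ [c]) w" "strict_prefix t (hl c)"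
  using assms
proof (induction w arbitrary: p thesis)
  case (Cons c w)
  show ?case
  proof (cases "strict_prefix p (hl c)")
    case True
    then show ?thesis using Cons.prems(2)[of "[]" p c] by simp
  next
    case False
    then obtain s where s: "p = hl c @ s" "Sublist.prefix s (h w)"
      using Cons.prems(3) by (auto simp: prefix_append strict_prefix_def)
    show ?thesis
    proof (rule Cons.IH[OF _ _ s(2)])
      assume "s = h w"
      then show thesis using Cons.prems(1) s(1) by simp
    next
      fix u e t
      assume "s = h u @ t" "Sublist.prefix (u @ [e]) w" "strict_prefix t (hl e)"
      then show thesis using Cons.prems(2)[of "c # u" t e] s(1) by simp
    qed
  qed
qed simp

section \<open>Proper prefixes of the images and their weights modulo 31\<close>

definition residues :: "nat list" where
  "residues = [0,1,4,5,6,7,10,11,12,13,15,16,17,18,19,20,22,23,24,27,28]"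

text \<open>A proper prefix of weight at most 16 is determined up to permutation by its weight, and so is
  the complementary suffix of a proper prefix of weight greater than 16. The prefixes of weight 19
  show that a case distinction is needed: they have Parikh vectors (10, 3) and (7, 4).\<close>

definition b_before :: "nat \<Rightarrow> nat" where
  "b_before r = (if r < 4 then 0 else if r < 10 then 1 else if r < 14 then 2 else 3)"

definition b_after :: "nat \<Rightarrow> nat" where
  "b_after r = (if r \<le> 20 then 3 else if r \<le> 24 then 2 else 1)"

lemma strict_prefix_hl:
  assumes "strict_prefix t (hl c)"
  shows "weight t \<in> set residues"
    and "weight t \<le> 16 \<Longrightarrow> count_list t B = b_before (weight t)"
    and "16 < weight t \<Longrightarrow> count_list (hl c) B = count_list t B + b_after (weight t)"
proof -
  let ?P = "\<lambda>t. weight t \<in> set residues \<and>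
      (weight t \<le> 16 \<longrightarrow> count_list t B = b_before (weight t)) \<and>
      (16 < weight t \<longrightarrow> count_list (hl c) B = count_list t B + b_after (weight t))"
  have "list_all (\<lambda>t. t = hl c \<or> ?P t) (prefixes (hl c))"
    by (cases c) (simp_all add: weight_def residues_def b_before_def b_after_def)
  moreover have "t \<in> set (prefixes (hl c))" "t \<noteq> hl c"
    using assms by (auto simp only: in_set_prefixes strict_prefix_def)
  ultimately have "?P t"
    unfolding list_all_iff by blast
  then show "weight t \<in> set residues"
    and "weight t \<le> 16 \<Longrightarrow> count_list t B = b_before (weight t)"
    and "16 < weight t \<Longrightarrow> count_list (hl c) B = count_list t B + b_after (weight t)"
    by blast+
qed

text \<open>The ten constants are the numbers below 31 missing from \<open>residues\<close>.\<close>

fun escapes :: "nat \<Rightarrow> int \<Rightarrow> int \<Rightarrow> bool" where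
  "escapes 0 s g \<longleftrightarrow> False"
| "escapes (Suc k) s g \<longleftrightarrow>
    (if s mod 31 \<in> {2,3,8,9,14,21,25,26,29,30} then True else escapes k (s + g) g)"

lemma escapesD:
  "escapes k s g \<Longrightarrow> \<exists>j<k. (s + int j * g) mod 31 \<in> {2,3,8,9,14,21,25,26,29,30}"
proof (induction k arbitrary: s)
  case (Suc k)
  show ?case
  proof (cases "s mod 31 \<in> {2,3,8,9,14,21,25,26,29,30}")
    case True
    then show ?thesis by (intro exI[of _ 0]) simp
  next
    case False
    then obtain j where "j < k" "(s + g + int j * g) mod 31 \<in> {2,3,8,9,14,21,25,26,29,30}"
      using Suc by auto
    then show ?thesis by (intro exI[of _ "Suc j"]) (simp add: algebra_simps)
  qed
qed simp

text \<open>Exhaustive evaluation over the 930 pairs of a start and a nonzero difference modulo 31.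
  The ten terms correspond to the ten cuts of a ninth power.\<close>

lemma escapes_progression:
  assumes "0 \<le> s" "s < 31" "0 < g" "g < (31 :: int)"
  shows "escapes 10 s g"
proof -
  have "\<forall>g \<in> set [1..30]. \<forall>s \<in> set [0..30]. escapes 10 s g"
    by code_simp
  then show ?thesis using assms by auto
qed

lemma residues_no_progression:
  assumes res: "\<And>k. k \<le> 9 \<Longrightarrow> (s + k * g) mod 31 \<in> set residues"
  shows "g mod 31 = 0"
proof (rule ccontr)
  assume "g mod 31 \<noteq> 0"
  then have "escapes 10 (int (s mod 31)) (int (g mod 31))"
    by (intro escapes_progression) (auto simp flip: of_nat_mod)
  then obtain j where j: "j < 10"
    "(int (s mod 31) + int j * int (g mod 31)) mod 31 \<in> {2,3,8,9,14,21,25,26,29,30}"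
    using escapesD by blast
  have "(int (s mod 31) + int j * int (g mod 31)) mod 31 = int ((s + j * g) mod 31)"
    by (simp add: of_nat_mod) (rule mod_add_cong[OF mod_mod_trivial mod_mult_right_eq])
  moreover have "(s + j * g) mod 31 \<in> set residues"
    using res j(1) by simp
  ultimately show False
    using j(2) by (auto simp: residues_def)
qed

section \<open>Preservation of abelian 9-power freeness\<close>

lemma abelian_power_free_h:
  assumes free: "abelian_power_free 9 w"
  shows "abelian_power_free 9 (h w)"
proof (rule ccontr)
  assume "\<not> abelian_power_free 9 (h w)"
  then obtain p d c0 where
    pre: "\<And>j. j \<le> 9 \<Longrightarrow> Sublist.prefix (p j) (h w)" and
    cnt: "\<And>j c. j \<le> 9 \<Longrightarrow> count_list (p j) c = count_list (p 0) c + j * d c" and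
    d: "0 < d c0"
    by (rule not_abelian_power_freeE) (rule that)
  have d_pos: "0 < d A + d B"
    using d by (cases c0) auto
  have "\<exists>u t. p j = h u @ t \<and> (t = [] \<and> Sublist.prefix u w \<or>
      (\<exists>c. Sublist.prefix (u @ [c]) w \<and> strict_prefix t (hl c)))" if "j \<le> 9" for j
    by (rule prefix_h_cases[OF pre[OF that]]) (auto intro: append_Nil2[symmetric])
  then obtain u t where ut: "\<And>j. j \<le> 9 \<Longrightarrow> p j = h (u j) @ t j"
      "\<And>j. j \<le> 9 \<Longrightarrow> t j = [] \<and> Sublist.prefix (u j) w \<or>
        (\<exists>c. Sublist.prefix (u j @ [c]) w \<and> strict_prefix (t j) (hl c))"
    by metis
  \<comment> \<open>Every \<open>t j\<close> is a proper prefix of the image of some letter, which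
    need not be the letter after \<open>u j\<close>: at the end of \<open>h w\<close> the empty
    \<open>t j\<close> is viewed as a prefix of \<open>hl A\<close>.\<close>
  have "strict_prefix [] (hl A)" by (simp add: strict_prefix_def)
  then have "\<exists>c. strict_prefix (t j) (hl c)" if "j \<le> 9" for j
    using ut(2)[OF that] by metis
  then obtain b where b: "\<And>j. j \<le> 9 \<Longrightarrow> strict_prefix (t j) (hl (b j))"
    by metis
  have t_res: "weight (t j) \<in> set residues" if "j \<le> 9" for j
    by (rule strict_prefix_hl(1)[OF b[OF that]])
  have "weight (t j) < 31" if "j \<le> 9" for j
    using t_res[OF that] by (auto simp: residues_def)
  then have t_mod: "weight (t j) = weight (p j) mod 31" if "j \<le> 9" for j
    using that by (simp only: ut(1) weight_append weight_h mod_mult_self4 mod_less)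
  define g where "g = d A + 3 * d B"
  have p_weight: "weight (p j) = weight (p 0) + j * g" if "j \<le> 9" for j
    using cnt[OF that] by (simp add: weight_def g_def algebra_simps)
  have "g mod 31 = 0"
    using residues_no_progression[of "weight (p 0)" g] t_res t_mod p_weight by metis
  then obtain k where "g = 31 * k"
    by (auto simp: mod_eq_0_iff_dvd elim: dvdE)
  then have "weight (p j) = weight (p 0) + 31 * (j * k)" if "j \<le> 9" for j
    using p_weight[OF that] by simp
  then have t_const: "weight (t j) = weight (t 0)" if "j \<le> 9" for j
    using t_mod[OF that] t_mod[of 0] that by (metis mod_mult_self2 le0)

  text \<open>Move all ten cuts to block boundaries by the same Parikh vector: to the left if the
    common residue is at most 16, to the right otherwise.\<close>
  have "\<exists>q. (\<forall>j\<le>9. Sublist.prefix (q j) w) \<and>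
    (\<forall>j\<le>9. \<forall>c. count_list (h (q j)) c = count_list (h (q 0)) c + j * d c)"
  proof (cases "weight (t 0) \<le> 16")
    case True
    have tB: "count_list (t j) B = count_list (t 0) B" if "j \<le> 9" for j
      using strict_prefix_hl(2)[OF b[OF that]] strict_prefix_hl(2)[OF b[of 0]] True t_const[OF that]
      by simp
    have tA: "count_list (t j) A = count_list (t 0) A" if "j \<le> 9" for j
      using tB[OF that] t_const[OF that] by (simp add: weight_def)
    have tc: "count_list (t j) c = count_list (t 0) c" if "j \<le> 9" for j c
      using tA[OF that] tB[OF that] by (cases c) auto
    have "count_list (h (u j)) c = count_list (h (u 0)) c + j * d c" if "j \<le> 9" for j c
      using cnt[OF that, of c] ut(1)[OF that] ut(1)[of 0] tc[OF that, of c] by simp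
    moreover have "Sublist.prefix (u j) w" if "j \<le> 9" for j
      using ut(2)[OF that] by (auto simp: prefix_def)
    ultimately show ?thesis by blast
  next
    case False
    \<comment> \<open>A weight above 16 excludes an empty \<open>t j\<close>, so a letter really
      follows \<open>u j\<close> in \<open>w\<close>; the shift to the right completes its
      block.\<close>
    have "\<exists>c. Sublist.prefix (u j @ [c]) w \<and> strict_prefix (t j) (hl c)" if "j \<le> 9" for j
      using ut(2)[OF that] t_const[OF that] False by (auto simp: weight_def)
    then obtain e where e: "\<And>j. j \<le> 9 \<Longrightarrow> Sublist.prefix (u j @ [e j]) w"
        "\<And>j. j \<le> 9 \<Longrightarrow> strict_prefix (t j) (hl (e j))"
      by metis
    define r where "r = b_after (weight (t 0))"
    have rB: "count_list (hl (e j)) B = count_list (t j) B + r" if "j \<le> 9" for j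
      using strict_prefix_hl(3)[OF e(2)[OF that]] t_const[OF that] False by (simp add: r_def)
    \<comment> \<open>Every block has weight 31, so the missing suffix has weight
      \<open>31 - weight (t 0)\<close>; as it contains \<open>r\<close> letters \<open>B\<close>,
      its number of letters \<open>A\<close> is fixed too.\<close>
    have rA: "count_list (hl (e j)) A + (weight (t 0) + 3 * r) = count_list (t j) A + 31"
      if "j \<le> 9" for j
      using rB[OF that] t_const[OF that] weight_hl[of "e j"] unfolding weight_def by linarith
    \<comment> \<open>The completing suffix has the same Parikh vector for all \<open>j\<close>,
      written with sums because subtraction on naturals truncates.\<close>
    have ec: "count_list (hl (e j)) c + count_list (t 0) c =
        count_list (hl (e 0)) c + count_list (t j) c"
      if "j \<le> 9" for j c
      using rA[OF that] rA[of 0] rB[OF that] rB[of 0] by (cases c) auto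
    have "count_list (h (u j @ [e j])) c = count_list (h (u 0 @ [e 0])) c + j * d c"
      if "j \<le> 9" for j c
      using cnt[OF that, of c] ut(1)[OF that] ut(1)[of 0] ec[OF that, of c] by simp
    then show ?thesis using e(1) by (intro exI[of _ "\<lambda>j. u j @ [e j]"]) blast
  qed
  then obtain q where q: "\<And>j. j \<le> 9 \<Longrightarrow> Sublist.prefix (q j) w"
    and q_cnt: "\<And>j c. j \<le> 9 \<Longrightarrow> count_list (h (q j)) c = count_list (h (q 0)) c + j * d c"
    by blast
  have q_A: "13 * count_list (q j) A + 10 * count_list (q j) B =
      13 * count_list (q 0) A + 10 * count_list (q 0) B + j * d A" if "j \<le> 9" for j
    using q_cnt[OF that, of A] by (simp add: count_h)
  have q_B: "6 * count_list (q j) A + 7 * count_list (q j) B =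
      6 * count_list (q 0) A + 7 * count_list (q 0) B + j * d B" if "j \<le> 9" for j
    using q_cnt[OF that, of B] by (simp add: count_h)
  have "Sublist.prefix (q 0) (q 1) \<or> Sublist.prefix (q 1) (q 0)"
    using q[of 0] q[of 1] prefix_same_cases by auto
  \<comment> \<open>In the reverse order \<open>h (q 1)\<close> could not be longer than
    \<open>h (q 0)\<close>, yet their lengths differ by \<open>d A + d B\<close>, which is
    positive.\<close>
  moreover have "\<not> Sublist.prefix (q 1) (q 0)"
  proof
    assume "Sublist.prefix (q 1) (q 0)"
    then have "count_list (q 1) c \<le> count_list (q 0) c" for c
      by (auto simp: prefix_def)
    from this[of A] this[of B] show False
      using q_A[of 1] q_B[of 1] d_pos by simp
  qed
  ultimately obtain v where v: "q 1 = q 0 @ v"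
    by (auto simp: prefix_def)
  have dA: "d A = 13 * count_list v A + 10 * count_list v B"
    and dB: "d B = 6 * count_list v A + 7 * count_list v B"
    using q_A[of 1] q_B[of 1] unfolding v by simp_all
  \<comment> \<open>Both sides solve the same linear system with matrix rows (13, 10) and (6, 7).
    Its determinant 31 is nonzero, so they agree, and the Parikh vector of \<open>v\<close> is the
    common difference.\<close>
  have cnt_q: "count_list (q j) c = count_list (q 0) c + j * count_list v c" if "j \<le> 9" for j c
  proof -
    have "13 * count_list (q j) A + 10 * count_list (q j) B = 13 * count_list (q 0) A +
        10 * count_list (q 0) B + 13 * (j * count_list v A) + 10 * (j * count_list v B)"
      "6 * count_list (q j) A + 7 * count_list (q j) B = 6 * count_list (q 0) A +
        7 * count_list (q 0) B + 6 * (j * count_list v A) + 7 * (j * count_list v B)"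
      using q_A[OF that] q_B[OF that] unfolding dA dB by (simp_all add: algebra_simps)
    then show ?thesis by (cases c; hypsubst; linarith)
  qed
  have "0 < count_list v A \<or> 0 < count_list v B"
    using d_pos unfolding dA dB by linarith
  then obtain c where "0 < count_list v c" by blast
  then have "\<not> abelian_power_free 9 w"
    by (intro not_abelian_power_freeI[of 9 q w "count_list v" c] q cnt_q) simp_all
  with free show False by simp
qed

section \<open>The fixed point as the limit of the iterates on \<open>A\<close>\<close>

lemma prefix_h: "Sublist.prefix u v \<Longrightarrow> Sublist.prefix (h u) (h v)"
  by (auto simp: prefix_def)

definition approx :: "nat \<Rightarrow> letter list" where
  "approx n = (h ^^ n) [A]"

text \<open>Letter \<open>i\<close> is read off an iterate that is long enough, since
  \<open>approx n\<close> has more than \<open>n\<close> letters.\<close>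

definition fixpoint :: "letter word" where
  "fixpoint i = approx (Suc i) ! i"

lemma approx_Suc: "approx (Suc n) = h (approx n)"
  by (simp add: approx_def)

text \<open>\<open>hl A\<close> begins with \<open>A\<close>, so \<open>approx 0\<close> is a prefix
  of \<open>approx 1\<close>; applying \<open>h\<close> carries this along the chain.\<close>

lemma prefix_approx: "m \<le> n \<Longrightarrow> Sublist.prefix (approx m) (approx n)"
proof (induction rule: dec_induct)
  case (step n)
  have "Sublist.prefix (approx n) (approx (Suc n))"
  proof (induction n)
    case 0
    show ?case by (simp add: approx_def)
  next
    case (Suc n)
    then show ?case using prefix_h by (simp add: approx_Suc)
  qed
  then show ?case using step.IH by (rule prefix_order.trans[rotated])
qed simp

lemma length_h_ge: "2 * length w \<le> length (h w)"
proof (induction w)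
  case (Cons c w)
  then show ?case by (cases c) simp_all
qed simp

lemma length_approx: "n < length (approx n)"
proof (induction n)
  case (Suc n)
  then show ?case using length_h_ge[of "approx n"] by (simp add: approx_Suc)
qed (simp add: approx_def)

lemma fixpoint_nth:
  assumes "i < length (approx n)"
  shows "fixpoint i = approx n ! i"
proof -
  have "i < length (approx (Suc i))"
    using length_approx[of "Suc i"] by simp
  moreover have "Sublist.prefix (approx n) (approx (Suc i)) \<or>
      Sublist.prefix (approx (Suc i)) (approx n)"
    using prefix_approx nat_le_linear by blast
  ultimately show ?thesis
    using assms by (auto simp: fixpoint_def prefix_def nth_append)
qed

text \<open>Transfers claims about finite prefixes of the infinite word to the iterates; the fixed
  point property, the power freeness and the excluded factors all rest on it.\<close>

lemma fixpoint_conc_iff: "(\<exists>y. fixpoint = u \<frown> y) \<longleftrightarrow> (\<exists>n. Sublist.prefix u (approx n))"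
proof
  assume "\<exists>y. fixpoint = u \<frown> y"
  then obtain y where y: "fixpoint = u \<frown> y" by blast
  have "u ! i = approx (length u) ! i" if "i < length u" for i
    using fixpoint_nth[of i "length u"] length_approx[of "length u"] that by (simp add: y)
  then have "u = take (length u) (approx (length u))"
    using length_approx[of "length u"] by (auto intro: nth_equalityI)
  then show "\<exists>n. Sublist.prefix u (approx n)"
    by (metis take_is_prefix)
next
  assume "\<exists>n. Sublist.prefix u (approx n)"
  then obtain n where n: "Sublist.prefix u (approx n)" by blast
  have "fixpoint i = u ! i" if "i < length u" for i
    using n that fixpoint_nth[of i n] by (auto simp: prefix_def nth_append)
  then have "fixpoint = u \<frown> (\<lambda>i. fixpoint (i + length u))"
    by (auto simp: conc_def)
  then show "\<exists>y. fixpoint = u \<frown> y" by blast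
qed

lemma omega_fixed_point_fixpoint: "omega_fixed_point h fixpoint"
proof -
  have image: "concat (map (\<lambda>i. h [fixpoint i]) [0..<n]) = h (take n (approx n))" for n
  proof -
    have "map fixpoint [0..<n] = take n (approx n)"
      using length_approx[of n] by (intro nth_equalityI) (auto simp: fixpoint_nth)
    moreover have "concat (map (\<lambda>i. h [fixpoint i]) xs) = h (map fixpoint xs)" for xs
      by (induction xs) simp_all
    ultimately show ?thesis by simp
  qed
  \<comment> \<open>The image of a prefix of \<open>approx n\<close> is a prefix of
    \<open>approx (Suc n)\<close>.\<close>
  have "\<exists>y. fixpoint = h (take n (approx n)) \<frown> y" for n
    unfolding fixpoint_conc_iff
    by (rule exI[of _ "Suc n"]) (simp add: approx_Suc prefix_h take_is_prefix)
  moreover have "m \<le> length (h (take m (approx m)))" for m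
    using length_h_ge[of "take m (approx m)"] length_approx[of m] by simp
  ultimately show ?thesis
    unfolding omega_fixed_point_def omega_image_def image by blast
qed

lemma abelian_power_free_approx: "abelian_power_free 9 (approx n)"
proof (induction n)
  case 0
  show ?case
  proof (rule ccontr)
    assume "\<not> abelian_power_free 9 (approx 0)"
    then obtain p d c0 where
      pre: "\<And>j. j \<le> 9 \<Longrightarrow> Sublist.prefix (p j) [A]" and
      cnt: "\<And>j c. j \<le> 9 \<Longrightarrow> count_list (p j) c = count_list (p 0) c + j * d c" and
      d: "0 < d c0"
      unfolding approx_def funpow_0 by (rule not_abelian_power_freeE) (rule that)
    \<comment> \<open>Nine blocks, each containing \<open>c0\<close>, need at least nine letters,
      but \<open>approx 0\<close> has only one.\<close>
    have "length (p 9) \<le> 1" using prefix_length_le[OF pre[of 9]] by simp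
    moreover have "9 \<le> count_list (p 9) c0" using cnt[of 9 c0] d by linarith
    moreover have "count_list (p 9) c0 \<le> length (p 9)" by (rule count_le_length)
    ultimately show False by linarith
  qed
next
  case (Suc n)
  then show ?case by (simp add: approx_Suc abelian_power_free_h)
qed

lemma omega_abelian_power_free_fixpoint: "omega_abelian_power_free 9 fixpoint"
  unfolding omega_abelian_power_free_def
proof (intro allI impI, elim conjE)
  fix x vs y
  assume "fixpoint = x \<frown> concat vs \<frown> y" and vs: "length vs = 9"
    "\<forall>v \<in> set vs. \<forall>v' \<in> set vs. parikh v = parikh v'"
  then have "\<exists>y. fixpoint = (x @ concat vs) \<frown> y" by auto
  then obtain n z where "approx n = x @ concat vs @ z"
    unfolding fixpoint_conc_iff by (auto simp: prefix_def)
  then show "\<forall>v \<in> set vs. v = []"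
    using abelian_power_free_approx[of n] vs unfolding abelian_power_free_def by blast
qed

section \<open>The excluded factors\<close>

text \<open>Testing every suffix at its start lets simplification evaluate the predicate on explicit
  words; \<open>take\<close> also copes with suffixes shorter than the pattern.\<close>

fun avoids :: "letter list \<Rightarrow> bool" where
  "avoids [] \<longleftrightarrow> True"
| "avoids (c # w) \<longleftrightarrow> take 4 (c # w) \<noteq> [A,A,A,A] \<and> take 2 (c # w) \<noteq> [B,B] \<and> avoids w"

lemma avoids_appendD: "avoids (u @ v) \<Longrightarrow> avoids v"
  by (induction u) simp_all

text \<open>Only the seams between images need an argument: each image begins with \<open>A\<close>
  and ends in \<open>B\<close>, so neither forbidden factor can straddle a seam.\<close>

lemma avoids_h: "avoids (h w)"
proof (induction w)
  case (Cons c w)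
  have "h w = [] \<or> (\<exists>s. h w = A # B # s)"
  proof (cases w)
    case (Cons e w')
    then show ?thesis by (cases e) simp_all
  qed simp
  then show ?case using Cons by (cases c) auto
qed simp

lemma avoids_approx: "avoids (approx n)"
  by (cases n) (simp_all add: approx_Suc avoids_h, simp add: approx_def)

text \<open>The factor is brought to the front of a suffix of an iterate, because
  \<open>avoids\<close> unfolds to \<open>False\<close> on \<open>[A, A, A, A] @ s\<close> and on
  \<open>[B, B] @ s\<close>.\<close>

lemma omega_factor_fixpointD:
  assumes "omega_factor u fixpoint"
  obtains s where "avoids (u @ s)"
proof -
  obtain x y where "fixpoint = x \<frown> u \<frown> y"
    using assms unfolding omega_factor_def by blast
  then have "\<exists>y. fixpoint = (x @ u) \<frown> y" by auto
  then obtain n s where "approx n = x @ u @ s"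
    unfolding fixpoint_conc_iff by (auto simp: prefix_def)
  then show thesis
    using that avoids_approx[of n] avoids_appendD by metis
qed

theorem theorem2p16:
  shows "\<exists>(h :: letter list \<Rightarrow> letter list) (\<Omega>\<^sub>2 :: letter word).
           abelian_power_free_morphism 9 h \<and>
           omega_fixed_point h \<Omega>\<^sub>2 \<and>
           \<not> omega_factor [A, A, A, A] \<Omega>\<^sub>2 \<and>
           \<not> omega_factor [B, B] \<Omega>\<^sub>2 \<and>
           omega_abelian_power_free 9 \<Omega>\<^sub>2"
proof (intro exI conjI)
  show "abelian_power_free_morphism 9 h"
    by (simp add: abelian_power_free_morphism_def morphism_h abelian_power_free_h)
  show "omega_fixed_point h fixpoint"
    by (rule omega_fixed_point_fixpoint)
  show "\<not> omega_factor [A, A, A, A] fixpoint"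
    by (auto elim!: omega_factor_fixpointD)
  show "\<not> omega_factor [B, B] fixpoint"
    by (auto elim!: omega_factor_fixpointD)
  show "omega_abelian_power_free 9 fixpoint"
    by (rule omega_abelian_power_free_fixpoint)
qed

end
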